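(* Let $n,m,p\ge1$ be integers, $\mathcal A:\mathbb S^n\to\mathbb R^m$ a linear map, $b\in\mathbb R^m$, $R_Y,R_\lambda\in\mathbb R_+$, $\boldsymbol\varepsilon=(\varepsilon_0,\varepsilon_1,\varepsilon_2)\in\mathbb R_+^3$ and $\gamma>0$. Let $\delta:=\varepsilon_1\|\mathcal A\|/\gamma$ and $B_\lambda:=\{\lambda\in\mathbb R^m:\|\lambda\|\le R_\lambda\}$. Then $$\mathscr C_{\boldsymbol\varepsilon,\gamma}\;\subset\;\operatorname{tube}_\delta(\mathbb S^n_{n-p})+\mathcal A^*(B_\lambda)\;=\;\operatorname{tube}_\delta\big(\mathbb S^n_{n-p}+\mathcal A^*(B_\lambda)\big),$$ where $\mathscr C_{\boldsymbol\varepsilon,\gamma}\subset\mathbb S^n$ is the set of cost matrices $C$ for which there exists a spurious $(\boldsymbol\varepsilon,\gamma)$-AFAC pair.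
   Context: $\mathbb S^n$ is the space of real symmetric $n\times n$ matrices, $A\bullet B=\operatorname{tr}(A^TB)$, all matrix norms are Frobenius norms, $\mathbb R_+=[0,\infty)$. $\mathbb S^n_{n-p}=\{X\in\mathbb S^n:\operatorname{rank}X\le n-p\}$. For $\mathcal W\subset\mathbb S^n$ and $\delta\ge0$, $\operatorname{tube}_\delta\mathcal W=\{X\in\mathbb S^n:\|X-W\|\le\delta\text{ for some }W\in\mathcal W\}$. Sums of sets are Minkowski sums. $\mathcal A(X)=(A_1\bullet X,\dots,A_m\bullet X)$ with $A_i\in\mathbb S^n$ (also applied to nonsymmetric $X\in\mathbb R^{n\times n}$), $\mathcal A\ne0$, $\|\mathcal A\|$ is the operator norm, $\mathcal A^*(\lambda)=\sum_i\lambda_iA_i$. For $C\in\mathbb S^n$, $S(\lambda)=C-\mathcal A^*(\lambda)$; (SDP): $\min_{X\in\mathbb S^n} C\bullet X$ s.t. $\mathcal A(X)=b$, $X\succeq0$; (BM): $\min_{Y\in\mathbb R^{n\times p}}C\bullet YY^T$ s.t. $\mathcal A(YY^T)=b$. $(X,\lambda)$ is $(\varepsilon_0,\varepsilon_1,\varepsilon_2)$-approximately optimal for (SDP) if $\|\mathcal A(X)-b\|\le\varepsilon_0$, $\|S(\lambda)X\|\le\varepsilon_1$, $X\succeq0$, $S(\lambda)\succeq-\varepsilon_2I_n$. $(Y,\lambda)\in\mathbb R^{n\times p}\times\mathbb R^m$ is $(\boldsymbol\varepsilon,\gamma)$-AFAC for (BM) if $\|\mathcal A(YY^T)-b\|\le\varepsilon_0$,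 $\|S(\lambda)Y\|\le\varepsilon_1$, and $S(\lambda)\bullet UU^T\ge-\varepsilon_2$ for all $U\in\mathbb R^{n\times p}$ with $\|U\|=1$, $\|\mathcal A(UY^T)\|\le\gamma$. $(Y,\lambda)$ is a spurious $(\boldsymbol\varepsilon,\gamma)$-AFAC pair if it is $(\boldsymbol\varepsilon,\gamma)$-AFAC for (BM), $(YY^T,\lambda)$ is not $(\varepsilon_0,R_Y\varepsilon_1,\varepsilon_2)$-approximately optimal for (SDP), and $\|Y\|\le R_Y$, $\|\lambda\|\le R_\lambda$. *)

theory Defs
  imports "HOL-Analysis.Analysis" "HOL-Library.Set_Algebras"
begin

text \<open>
  Dimensions are index types: \<open>n\<close>, \<open>m\<close>, \<open>p\<close> are \<open>CARD('n)\<close>, \<open>CARD('m)\<close>, \<open>CARD('p)\<close>,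
  all at least 1. A real \<open>n \<times> p\<close> matrix has type \<open>real^'p^'n\<close>. On matrices, the
  inner product and norm of the type are the trace inner product and the Frobenius norm:
\<close>

lemma inner_matrix_eq_trace:
  fixes A B :: "real^'p::finite^'n::finite"
  shows "A \<bullet> B = trace (transpose A ** B)"
  unfolding trace_def transpose_def matrix_matrix_mult_def inner_vec_def
  by simp (rule sum.swap)

lemma norm_matrix_eq_Frobenius:
  fixes A :: "real^'p::finite^'n::finite"
  shows "norm A = sqrt (trace (transpose A ** A))"
  by (simp add: norm_eq_sqrt_inner inner_matrix_eq_trace)

definition sym_mats :: "(real^'n^'n) set" where
  "sym_mats = {X. transpose X = X}"

text \<open>The bound \<open>k\<close> is an integer, so that the set is empty for negative \<open>k\<close>
  (which occurs for \<open>k = n - p\<close> with \<open>p > n\<close>).\<close>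

definition sym_mats_rank_le :: "int \<Rightarrow> (real^'n^'n) set" where
  "sym_mats_rank_le k = {X \<in> sym_mats. int (rank X) \<le> k}"

definition tube :: "real \<Rightarrow> (real^'n^'n) set \<Rightarrow> (real^'n^'n) set" where
  "tube \<delta> W = {X \<in> sym_mats. \<exists>Z\<in>W. norm (X - Z) \<le> \<delta>}"

definition psd :: "real^'n^'n \<Rightarrow> bool" where
  "psd X \<longleftrightarrow> X \<in> sym_mats \<and> (\<forall>v. 0 \<le> v \<bullet> (X *v v))"

text \<open>A linear map from the symmetric matrices to \<open>real^'m\<close> is given by its family \<open>A\<close> of
  representing symmetric matrices, which also makes it applicable to nonsymmetric matrices.\<close>

definition lin_op :: "('m \<Rightarrow> real^'n^'n) \<Rightarrow> real^'n^'n \<Rightarrow> real^'m" where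
  "lin_op A X = (\<chi> i. A i \<bullet> X)"

definition adj_op :: "('m::finite \<Rightarrow> real^'n^'n) \<Rightarrow> real^'m \<Rightarrow> real^'n^'n" where
  "adj_op A l = (\<Sum>i\<in>UNIV. (l $ i) *\<^sub>R A i)"

text \<open>The operator norm, taken over symmetric matrices only. The lemma below shows that extending
  the map to all matrices does not change it. At \<open>X = 0\<close> the quotient is 0.\<close>

definition op_norm :: "('m::finite \<Rightarrow> real^'n^'n) \<Rightarrow> real" where
  "op_norm A = (SUP X\<in>sym_mats. norm (lin_op A X) / norm X)"

lemma linear_lin_op: "linear (lin_op (A :: 'm::finite \<Rightarrow> real^'n::finite^'n))"
  by (rule linearI) (simp_all add: lin_op_def vec_eq_iff inner_add_right)

lemma op_norm_eq_onorm:
  fixes A :: "'m::finite \<Rightarrow> real^'n::finite^'n"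
  assumes sym: "\<And>i. A i \<in> sym_mats"
  shows "op_norm A = onorm (lin_op A)"
proof -
  let ?f = "lin_op A"
  have bl: "bounded_linear ?f"
    using linear_lin_op linear_conv_bounded_linear by blast
  have bdd: "bdd_above (range (\<lambda>X. norm (?f X) / norm X))"
    using le_onorm[OF bl] by (intro bdd_aboveI[of _ "onorm ?f"]) auto
  have z: "(0::real^'n^'n) \<in> sym_mats"
    by (simp add: sym_mats_def transpose_def vec_eq_iff)
  have t_inner: "transpose X \<bullet> transpose Y = X \<bullet> Y" for X Y :: "real^'n^'n"
    unfolding transpose_def inner_vec_def
    by simp (rule sum.swap)
  have t_add: "transpose (X + Y) = transpose X + transpose Y" for X Y :: "real^'n^'n"
    by (simp add: transpose_def vec_eq_iff)
  have "\<exists>Y\<in>sym_mats. norm (?f X) / norm X \<le> norm (?f Y) / norm Y" for X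
  proof -
    define Y where "Y = (1/2) *\<^sub>R (X + transpose X)"
    have Y: "Y \<in> sym_mats"
      by (simp add: Y_def sym_mats_def transpose_def vec_eq_iff add.commute)
    have "A i \<bullet> transpose X = A i \<bullet> X" for i
      using t_inner[of "A i" X] sym[of i] by (simp add: sym_mats_def)
    hence f: "?f Y = ?f X"
      by (simp add: Y_def lin_op_def vec_eq_iff inner_add_right)
    have "norm (transpose X) = norm X"
      by (simp add: norm_eq_sqrt_inner t_inner)
    hence n: "norm Y \<le> norm X"
      using norm_triangle_ineq[of X "transpose X"] by (simp add: Y_def)
    show ?thesis
    proof (cases "Y = 0")
      case True
      hence "?f X = 0" using f bl by (simp add: linear_simps(3))
      thus ?thesis using z by (intro bexI[of _ 0]) auto
    next
      case False
      thus ?thesis using Y f n by (intro bexI[of _ Y] ) (auto intro!: divide_left_mono mult_pos_pos)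
    qed
  qed
  hence "onorm ?f \<le> op_norm A"
    unfolding onorm_def op_norm_def
    by (intro cSUP_mono) (auto intro: bdd_above_mono[OF bdd])
  moreover have "op_norm A \<le> onorm ?f"
    unfolding onorm_def op_norm_def using z bdd
    by (intro cSUP_subset_mono) auto
  ultimately show ?thesis by simp
qed

definition slack :: "('m::finite \<Rightarrow> real^'n^'n) \<Rightarrow> real^'n^'n \<Rightarrow> real^'m \<Rightarrow> real^'n^'n" where
  "slack A C l = C - adj_op A l"

text \<open>Approximate optimality of \<open>(X, l)\<close> for the semidefinite program: minimize \<open>C \<bullet> X\<close> over
  symmetric \<open>X\<close> subject to \<open>lin_op A X = b\<close> and \<open>psd X\<close>.\<close>

definition sdp_approx_opt ::
  "('m::finite \<Rightarrow> real^'n^'n) \<Rightarrow> real^'m \<Rightarrow> real^'n^'n \<Rightarrow> real \<Rightarrow> real \<Rightarrow> real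
    \<Rightarrow> real^'n^'n \<Rightarrow> real^'m \<Rightarrow> bool" where
  "sdp_approx_opt A b C \<epsilon>0 \<epsilon>1 \<epsilon>2 X l \<longleftrightarrow>
     norm (lin_op A X - b) \<le> \<epsilon>0 \<and>
     norm (slack A C l ** X) \<le> \<epsilon>1 \<and>
     psd X \<and>
     psd (slack A C l - (- \<epsilon>2) *\<^sub>R mat 1)"

text \<open>Approximately feasible, approximately critical pairs \<open>(Y, l)\<close> for the Burer--Monteiro problem:
  minimize \<open>C \<bullet> (Y ** transpose Y)\<close> over \<open>n \<times> p\<close> matrices \<open>Y\<close> subject to
  \<open>lin_op A (Y ** transpose Y) = b\<close>.\<close>

definition afac ::
  "('m::finite \<Rightarrow> real^'n^'n) \<Rightarrow> real^'m \<Rightarrow> real^'n^'n \<Rightarrow> real \<Rightarrow> real \<Rightarrow> real \<Rightarrow> real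
    \<Rightarrow> real^'p^'n \<Rightarrow> real^'m \<Rightarrow> bool" where
  "afac A b C \<epsilon>0 \<epsilon>1 \<epsilon>2 \<gamma> Y l \<longleftrightarrow>
     norm (lin_op A (Y ** transpose Y) - b) \<le> \<epsilon>0 \<and>
     norm (slack A C l ** Y) \<le> \<epsilon>1 \<and>
     (\<forall>U :: real^'p^'n. norm U = 1 \<and> norm (lin_op A (U ** transpose Y)) \<le> \<gamma> \<longrightarrow>
        slack A C l \<bullet> (U ** transpose U) \<ge> - \<epsilon>2)"

definition spurious_afac ::
  "('m::finite \<Rightarrow> real^'n^'n) \<Rightarrow> real^'m \<Rightarrow> real \<Rightarrow> real \<Rightarrow> real^'n^'n
    \<Rightarrow> real \<Rightarrow> real \<Rightarrow> real \<Rightarrow> real \<Rightarrow> real^'p^'n \<Rightarrow> real^'m \<Rightarrow> bool" where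
  "spurious_afac A b R\<^sub>Y R\<^sub>l C \<epsilon>0 \<epsilon>1 \<epsilon>2 \<gamma> Y l \<longleftrightarrow>
     afac A b C \<epsilon>0 \<epsilon>1 \<epsilon>2 \<gamma> Y l \<and>
     \<not> sdp_approx_opt A b C \<epsilon>0 (R\<^sub>Y * \<epsilon>1) \<epsilon>2 (Y ** transpose Y) l \<and>
     norm Y \<le> R\<^sub>Y \<and> norm l \<le> R\<^sub>l"

text \<open>The number \<open>p\<close> of columns enters only through the type of \<open>Y\<close>, hence the explicit type
  argument.\<close>

definition spurious_costs ::
  "'p::finite itself \<Rightarrow> ('m::finite \<Rightarrow> real^'n^'n) \<Rightarrow> real^'m \<Rightarrow> real \<Rightarrow> real
    \<Rightarrow> real \<Rightarrow> real \<Rightarrow> real \<Rightarrow> real \<Rightarrow> (real^'n^'n) set" where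
  "spurious_costs (_ :: 'p itself) A b R\<^sub>Y R\<^sub>l \<epsilon>0 \<epsilon>1 \<epsilon>2 \<gamma> =
     {C \<in> sym_mats. \<exists>(Y :: real^'p^'n) l. spurious_afac A b R\<^sub>Y R\<^sub>l C \<epsilon>0 \<epsilon>1 \<epsilon>2 \<gamma> Y l}"

end

theory Submission
  imports Defs
begin

text \<open>
  At a spurious pair \<open>(Y, \<lambda>)\<close> the slack matrix \<open>S\<close> has a unit vector \<open>v\<close> with
  \<open>v \<bullet> S v < - \<epsilon>2\<close>. Testing the second-order condition with the rank-one directions \<open>v u\<^sup>T\<close>,
  \<open>u\<close> a unit vector, forces \<open>\<gamma> < \<parallel>A\<parallel> \<parallel>Y u\<parallel>\<close>, so all \<open>p\<close> singular values of \<open>Y\<close> exceed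
  \<open>\<gamma> / \<parallel>A\<parallel>\<close>. Together with \<open>\<parallel>S Y\<parallel> \<le> \<epsilon>1\<close> this makes \<open>S\<close> small on a \<open>p\<close>-dimensional
  subspace, and by Ky Fan's inequality for \<open>S\<^sup>2\<close> the \<open>p\<close> eigenvalues of \<open>S\<close> of least modulus
  have Euclidean norm at most \<open>\<epsilon>1 \<parallel>A\<parallel> / \<gamma>\<close>. Discarding them leaves a symmetric matrix
  of rank at most \<open>n - p\<close>.
\<close>

section \<open>Orthonormal sets and the spectral theorem\<close>

lemma norm_sum_orthonormal:
  fixes B :: "'a::real_inner set"
  assumes "finite B" "pairwise orthogonal B" "\<And>x. x \<in> B \<Longrightarrow> norm x = 1"
  shows "(norm (\<Sum>x\<in>B. c x *\<^sub>R x))\<^sup>2 = (\<Sum>x\<in>B. (c x)\<^sup>2)"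
proof -
  have "(norm (\<Sum>x\<in>B. c x *\<^sub>R x))\<^sup>2 = (\<Sum>x\<in>B. (norm (c x *\<^sub>R x))\<^sup>2)"
    using assms(1,2)
    by (intro norm_sum_Pythagorean) (auto simp: pairwise_def orthogonal_def)
  also have "\<dots> = (\<Sum>x\<in>B. (c x)\<^sup>2)"
    by (intro sum.cong) (simp_all add: assms(3))
  finally show ?thesis .
qed

lemma Parseval_orthonormal:
  fixes B :: "'a::euclidean_space set"
  assumes "finite B" "pairwise orthogonal B" "\<And>y. y \<in> B \<Longrightarrow> norm y = 1" "x \<in> span B"
  shows "(\<Sum>y\<in>B. (x \<bullet> y)\<^sup>2) = (norm x)\<^sup>2"
  using norm_sum_orthonormal[OF assms(1-3), of "\<lambda>y. x \<bullet> y"]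
    orthonormal_basis_expand[OF assms(2,3,4,1)] by simp

lemma Bessel_orthonormal:
  fixes B :: "'a::real_inner set"
  assumes "finite B" "pairwise orthogonal B" "\<And>y. y \<in> B \<Longrightarrow> norm y = 1"
  shows "(\<Sum>y\<in>B. (x \<bullet> y)\<^sup>2) \<le> (norm x)\<^sup>2"
proof -
  let ?s = "\<Sum>y\<in>B. (x \<bullet> y) *\<^sub>R y"
  have "x \<bullet> ?s = (\<Sum>y\<in>B. (x \<bullet> y)\<^sup>2)"
    by (simp add: inner_sum_right power2_eq_square)
  moreover have "?s \<bullet> ?s = (\<Sum>y\<in>B. (x \<bullet> y)\<^sup>2)"
    using norm_sum_orthonormal[OF assms, of "\<lambda>y. x \<bullet> y"] by (simp add: power2_norm_eq_inner)
  moreover have "0 \<le> (x - ?s) \<bullet> (x - ?s)"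
    by (rule inner_ge_zero)
  ultimately show ?thesis
    by (simp add: inner_diff_left inner_diff_right inner_commute[of ?s x] power2_norm_eq_inner)
qed

lemma independent_orthonormal:
  assumes "pairwise orthogonal B" "\<And>y. y \<in> B \<Longrightarrow> norm y = 1"
  shows "independent B"
  using assms by (intro pairwise_orthogonal_independent) force+

text \<open>A maximizer of the quadratic form on the unit sphere of \<open>V\<close> is an eigenvector.\<close>

lemma selfadjoint_eigenvector:
  fixes f :: "'a::euclidean_space \<Rightarrow> 'a"
  assumes lin: "linear f" and sa: "\<And>x y. f x \<bullet> y = x \<bullet> f y"
    and V: "subspace V" "f ` V \<subseteq> V" "V \<noteq> {0}"
  obtains e c where "e \<in> V" "norm e = 1" "f e = c *\<^sub>R e"
proof -
  let ?K = "V \<inter> sphere 0 1"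
  have comp: "compact ?K"
    using closed_subspace[OF V(1)] by (intro closed_Int_compact compact_sphere)
  obtain v where v: "v \<in> V" "v \<noteq> 0"
    using V(1,3) subspace_0 by blast
  have "v /\<^sub>R norm v \<in> ?K"
    using v V(1) by (simp add: subspace_scale)
  hence ne: "?K \<noteq> {}" by blast
  have "continuous_on ?K (\<lambda>x. x \<bullet> f x)"
    using lin by (intro continuous_intros linear_continuous_on) (simp add: linear_conv_bounded_linear)
  from continuous_attains_sup[OF comp ne this]
  obtain e where e: "e \<in> V" "norm e = 1" and max: "\<And>x. x \<in> ?K \<Longrightarrow> x \<bullet> f x \<le> e \<bullet> f e"
    by auto
  define c where "c = e \<bullet> f e"
  \<comment> \<open>By maximality the form of \<open>g\<close> is nonnegative on \<open>V\<close>,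
    and it vanishes at \<open>e\<close>. The variation below shows that such a zero lies in the
    kernel of \<open>g\<close>.\<close>
  define g where "g x = c *\<^sub>R x - f x" for x
  have Q: "0 \<le> x \<bullet> g x" if x: "x \<in> V" for x
  proof (cases "x = 0")
    case False
    have "x /\<^sub>R norm x \<in> ?K"
      using False x V(1) by (simp add: subspace_scale)
    from max[OF this] have "x \<bullet> f x / (norm x)\<^sup>2 \<le> c"
      by (simp add: c_def linear_scale[OF lin] field_simps power2_eq_square)
    hence "x \<bullet> f x \<le> c * (norm x)\<^sup>2"
      using False by (simp add: field_simps)
    thus ?thesis
      by (simp add: g_def inner_diff_right power2_norm_eq_inner)
  qed simp
  have g_lin: "g (x - s *\<^sub>R y) = g x - s *\<^sub>R g y" for x y s
    by (simp add: g_def linear_diff[OF lin] linear_scale[OF lin] algebra_simps)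
  have g_sa: "g x \<bullet> y = x \<bullet> g y" for x y
    by (simp add: g_def inner_diff_left inner_diff_right sa)
  define y where "y = g e"
  have yV: "y \<in> V"
    using e V(1,2) unfolding y_def g_def by (intro subspace_diff subspace_scale) auto
  have Qe: "e \<bullet> g e = 0"
    using e by (simp add: g_def c_def inner_diff_right norm_eq_1)
  \<comment> \<open>The form of \<open>g\<close> at \<open>e - s y\<close> has first-order term
    \<open>- 2 s (y \<bullet> y)\<close> and only a quadratic term to compensate it; dividing by
    \<open>s\<close> leaves this bound.\<close>
  have small: "2 * (y \<bullet> y) \<le> s * (y \<bullet> g y)" if "0 < s" for s
  proof -
    have "0 \<le> (e - s *\<^sub>R y) \<bullet> g (e - s *\<^sub>R y)"
      using e(1) yV V(1) by (intro Q subspace_diff subspace_scale)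
    also have "\<dots> = s * (s * (y \<bullet> g y) - 2 * (y \<bullet> y))"
      using Qe g_sa[of e y]
      by (simp add: g_lin inner_diff_left inner_diff_right y_def[symmetric] algebra_simps)
    finally show ?thesis
      using that by (simp add: zero_le_mult_iff)
  qed
  have "y \<bullet> y = 0"
  proof (rule ccontr)
    assume "y \<bullet> y \<noteq> 0"
    hence pos: "0 < y \<bullet> y" by simp
    with small[of 1] have q: "0 < y \<bullet> g y" by linarith
    \<comment> \<open>This step size turns the right-hand side into \<open>y \<bullet> y\<close>,
      which is less than \<open>2 (y \<bullet> y)\<close>.\<close>
    from small[of "y \<bullet> y / (y \<bullet> g y)"] pos q show False by simp
  qed
  hence "f e = c *\<^sub>R e"
    by (simp add: y_def g_def)
  with e that show ?thesis by blast
qed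

text \<open>Induction on the dimension: the vectors of \<open>V\<close> orthogonal to a unit
  eigenvector form a smaller subspace, invariant because \<open>f\<close> is self-adjoint. Allowing
  any invariant \<open>V\<close> makes the induction hypothesis applicable to it.\<close>

lemma selfadjoint_eigenbasis_subspace:
  fixes f :: "'a::euclidean_space \<Rightarrow> 'a"
  assumes lin: "linear f" and sa: "\<And>x y. f x \<bullet> y = x \<bullet> f y"
  shows "subspace V \<Longrightarrow> f ` V \<subseteq> V \<Longrightarrow>
    \<exists>B c. pairwise orthogonal B \<and> (\<forall>x\<in>B. norm x = 1 \<and> f x = c x *\<^sub>R x) \<and> span B = V"
proof (induction "dim V" arbitrary: V rule: less_induct)
  case less
  show ?case
  proof (cases "V = {0}")
    case True
    thus ?thesis by (intro exI[of _ "{}"]) auto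
  next
    case False
    from selfadjoint_eigenvector[OF lin sa less.prems False]
    obtain e c where e: "e \<in> V" "norm e = 1" "f e = c *\<^sub>R e" .
    define W where "W = {x \<in> V. x \<bullet> e = 0}"
    have W: "subspace W"
      using less.prems(1) by (auto simp: W_def subspace_def inner_add_left)
    have fW: "f ` W \<subseteq> W"
      using less.prems(2) e(3) sa by (auto simp: W_def)
    have "e \<notin> W" "W \<subseteq> V"
      using e(2) by (auto simp: W_def norm_eq_1)
    hence "W \<subset> V"
      using e(1) by blast
    hence "dim W < dim V"
      using W less.prems(1) by (metis dim_psubset span_eq_iff)
    from less.hyps[OF this W fW] obtain B d where
      B: "pairwise orthogonal B" "\<forall>x\<in>B. norm x = 1 \<and> f x = d x *\<^sub>R x" "span B = W" by blast
    have BW: "B \<subseteq> W" using B(3) span_superset by blast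
    hence "e \<notin> B" using e(2) by (auto simp: W_def norm_eq_1)
    have "span (insert e B) = V"
    proof
      show "span (insert e B) \<subseteq> V"
        using BW e(1) less.prems(1) by (intro span_minimal) (auto simp: W_def)
      show "V \<subseteq> span (insert e B)"
      proof
        fix x assume x: "x \<in> V"
        have "x - (x \<bullet> e) *\<^sub>R e \<in> W"
          using x e(1,2) less.prems(1)
          by (auto simp: W_def inner_diff_left norm_eq_1 intro!: subspace_diff subspace_scale)
        thus "x \<in> span (insert e B)"
          unfolding span_breakdown_eq B(3) by blast
      qed
    qed
    moreover have "pairwise orthogonal (insert e B)"
      using B(1) BW by (auto simp: pairwise_insert orthogonal_def W_def inner_commute)
    moreover have "\<forall>x\<in>insert e B. norm x = 1 \<and> f x = (d(e := c)) x *\<^sub>R x"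
      using B(2) e(2,3) \<open>e \<notin> B\<close> by auto
    ultimately show ?thesis by blast
  qed
qed

lemma selfadjoint_eigenbasis:
  fixes f :: "'a::euclidean_space \<Rightarrow> 'a"
  assumes "linear f" "\<And>x y. f x \<bullet> y = x \<bullet> f y"
  obtains B c where "finite B" "card B = DIM('a)" "pairwise orthogonal B" "span B = UNIV"
    "\<And>x. x \<in> B \<Longrightarrow> norm x = 1" "\<And>x. x \<in> B \<Longrightarrow> f x = c x *\<^sub>R x"
proof -
  obtain B c where B: "pairwise orthogonal B" "\<forall>x\<in>B. norm x = 1 \<and> f x = c x *\<^sub>R x" "span B = UNIV"
    using selfadjoint_eigenbasis_subspace[OF assms, of UNIV] by auto
  have ind: "independent B"
    using B by (intro independent_orthonormal) auto
  have "card B = DIM('a)"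
    using dim_eq_card_independent[OF ind] B(3) by (metis dim_span dim_UNIV)
  with B ind show ?thesis
    by (intro that[of B c]) (auto intro: independent_imp_finite)
qed

section \<open>Low-rank approximation of symmetric matrices\<close>

text \<open>Selects \<open>k\<close> smallest values without sorting: a minimizer over the remaining
  elements is added, and its value becomes the new threshold.\<close>

lemma threshold_subset:
  fixes g :: "'a \<Rightarrow> real"
  assumes "finite B" "\<And>x. x \<in> B \<Longrightarrow> 0 \<le> g x" "k \<le> card B"
  shows "\<exists>T t. T \<subseteq> B \<and> card T = k \<and> (\<forall>x\<in>T. g x \<le> t) \<and> (\<forall>x\<in>B - T. t \<le> g x)"
  using assms(3)
proof (induction k)
  case 0
  \<comment> \<open>For the empty selection the threshold 0 lies below all values, as
    \<open>g\<close> is nonnegative.\<close>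
  show ?case using assms(2) by (intro exI[of _ "{}"] exI[of _ 0]) auto
next
  case (Suc k)
  then obtain T t where T: "T \<subseteq> B" "card T = k" "\<forall>x\<in>T. g x \<le> t" "\<forall>x\<in>B - T. t \<le> g x" by auto
  have fin: "finite (B - T)" and ne: "B - T \<noteq> {}"
    using assms(1) T(1,2) Suc.prems by auto
  obtain z where z: "z \<in> B - T" "\<And>x. x \<in> B - T \<Longrightarrow> g z \<le> g x"
    using ex_is_arg_min_if_finite[OF fin ne, of g] by (auto simp: is_arg_min_linorder)
  have "card (insert z T) = Suc k"
    using z(1) T(1,2) assms(1) by (simp add: finite_subset)
  moreover have "\<forall>x\<in>insert z T. g x \<le> g z"
    using T(3,4) z(1) by (metis insertE order_refl order_trans)
  ultimately show ?case
    using T(1) z by (intro exI[of _ "insert z T"] exI[of _ "g z"]) auto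
qed

text \<open>The extremal principle behind Ky Fan's inequality: with total mass \<open>k\<close> and
  at most 1 per point, a weighted sum is least when the mass sits on \<open>k\<close> smallest
  values.\<close>

lemma sum_smallest_le_weighted_sum:
  fixes g w :: "'a \<Rightarrow> real"
  assumes "finite B" "\<And>x. x \<in> B \<Longrightarrow> 0 \<le> g x"
    and w: "\<And>x. x \<in> B \<Longrightarrow> 0 \<le> w x" "\<And>x. x \<in> B \<Longrightarrow> w x \<le> 1" "sum w B = real k"
  obtains T where "T \<subseteq> B" "card T = k" "sum g T \<le> (\<Sum>x\<in>B. w x * g x)"
proof -
  have "real k \<le> real (card B)"
    using sum_mono[of B w "\<lambda>_. 1"] w(2,3) by simp
  hence "k \<le> card B" by simp
  with threshold_subset[of B g k] assms(1,2) obtain T t where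
    T: "T \<subseteq> B" "card T = k" "\<forall>x\<in>T. g x \<le> t" "\<forall>x\<in>B - T. t \<le> g x" by auto
  have split: "sum h B = sum h (B - T) + sum h T" for h :: "'a \<Rightarrow> real"
    using sum.subset_diff[OF T(1) assms(1)] .
  \<comment> \<open>The mass outside \<open>T\<close> equals the mass missing inside
    \<open>T\<close>, namely \<open>k - sum w T\<close>. Each unit of it costs at least
    \<open>t\<close> outside and at most \<open>t\<close> inside.\<close>
  have "(\<Sum>x\<in>B - T. w x * t) \<le> (\<Sum>x\<in>B - T. w x * g x)"
    using w(1) T(4) by (intro sum_mono mult_left_mono) auto
  moreover have "(\<Sum>x\<in>T. (1 - w x) * g x) \<le> (\<Sum>x\<in>T. (1 - w x) * t)"
    using w(2) T(1,3) by (intro sum_mono mult_left_mono) auto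
  moreover have "(\<Sum>x\<in>T. (1 - w x) * g x) = sum g T - (\<Sum>x\<in>T. w x * g x)"
    by (simp add: left_diff_distrib sum_subtractf)
  moreover have "(\<Sum>x\<in>T. (1 - w x) * t) = (real k - sum w T) * t"
    by (simp add: sum_distrib_right[symmetric] sum_subtractf T(2))
  moreover have "(\<Sum>x\<in>B - T. w x * t) = (real k - sum w T) * t"
    using split[of w] w(3) by (simp add: sum_distrib_right[symmetric])
  ultimately have "sum g T \<le> (\<Sum>x\<in>B. w x * g x)"
    using split[of "\<lambda>x. w x * g x"] by linarith
  with T(1,2) that show ?thesis by blast
qed

section \<open>Frobenius norms and eigenbases of symmetric matrices\<close>

lemma power2_norm_vec: "(norm v)\<^sup>2 = (\<Sum>i\<in>UNIV. (norm (v $ i))\<^sup>2)"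
  for v :: "'a::real_inner^'n::finite"
  by (simp add: power2_norm_eq_inner inner_vec_def)

text \<open>Parseval's identity for each row of \<open>M\<close>, followed by an exchange of the two
  sums.\<close>

lemma norm_matrix_orthonormal_basis:
  fixes M :: "real^'p::finite^'n::finite"
  assumes B: "finite B" "pairwise orthogonal B" "\<And>x. x \<in> B \<Longrightarrow> norm x = 1" "span B = UNIV"
  shows "(norm M)\<^sup>2 = (\<Sum>x\<in>B. (norm (M *v x))\<^sup>2)"
proof -
  have "(norm M)\<^sup>2 = (\<Sum>i\<in>UNIV. \<Sum>x\<in>B. (M $ i \<bullet> x)\<^sup>2)"
    unfolding power2_norm_vec[of M] using B by (intro sum.cong refl Parseval_orthonormal[symmetric]) auto
  also have "\<dots> = (\<Sum>x\<in>B. \<Sum>i\<in>UNIV. (M $ i \<bullet> x)\<^sup>2)"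
    by (rule sum.swap)
  also have "\<dots> = (\<Sum>x\<in>B. (norm (M *v x))\<^sup>2)"
    by (simp add: power2_norm_vec matrix_vector_mul_component)
  finally show ?thesis .
qed

lemma inner_transpose_mult:
  fixes M :: "real^'p::finite^'n::finite"
  shows "(transpose M *v x) \<bullet> y = x \<bullet> (M *v y)"
  by (simp add: dot_lmul_matrix flip: vector_transpose_matrix)

lemma sym_mats_inner:
  assumes "S \<in> sym_mats"
  shows "(S *v x) \<bullet> y = x \<bullet> (S *v y)"
  using inner_transpose_mult[of S x y] assms by (simp add: sym_mats_def del: transpose_matrix_vector)

lemma sym_mats_eigenbasis:
  fixes S :: "real^'n::finite^'n"
  assumes S: "S \<in> sym_mats"
  obtains B c where "finite B" "card B = CARD('n)" "pairwise orthogonal B" "span B = UNIV"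
    "\<And>x. x \<in> B \<Longrightarrow> norm x = 1" "\<And>x. x \<in> B \<Longrightarrow> S *v x = c x *\<^sub>R x"
proof -
  have "(S *v x) \<bullet> y = x \<bullet> (S *v y)" for x y
    by (rule sym_mats_inner[OF S])
  from selfadjoint_eigenbasis[OF matrix_vector_mul_linear this] obtain B c where
    "finite B" "card B = DIM(real^'n)" "pairwise orthogonal B" "span B = UNIV"
    "\<And>x. x \<in> B \<Longrightarrow> norm x = 1" "\<And>x. x \<in> B \<Longrightarrow> S *v x = c x *\<^sub>R x"
    by blast
  thus ?thesis
    by (intro that[of B c]) simp_all
qed

text \<open>The approximant keeps the eigenvalues of largest modulus. Compressing \<open>S\<close> to the orthogonal
  complement of \<open>E\<close> instead would lose a factor \<open>sqrt 2\<close> in the bound.\<close>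

lemma low_rank_symmetric_approximation:
  fixes S :: "real^'n::finite^'n"
  assumes S: "S \<in> sym_mats"
    and E: "finite E" "pairwise orthogonal E" "\<And>e. e \<in> E \<Longrightarrow> norm e = 1"
  obtains Z where "Z \<in> sym_mats_rank_le (int CARD('n) - int (card E))"
    "(norm (S - Z))\<^sup>2 \<le> (\<Sum>e\<in>E. (norm (S *v e))\<^sup>2)"
proof -
  obtain B c where B: "finite B" "card B = CARD('n)" "pairwise orthogonal B" "span B = UNIV"
    "\<And>x. x \<in> B \<Longrightarrow> norm x = 1" "\<And>x. x \<in> B \<Longrightarrow> S *v x = c x *\<^sub>R x"
    using sym_mats_eigenbasis[OF S] by blast
  \<comment> \<open>\<open>w x\<close> is the squared length of the projection of \<open>x\<close>
    onto the span of \<open>E\<close>. Over \<open>B\<close> these weights have total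
    \<open>card E\<close> by Parseval, and each is at most 1 by Bessel.\<close>
  define w where "w x = (\<Sum>e\<in>E. (x \<bullet> e)\<^sup>2)" for x
  have "sum w B = (\<Sum>e\<in>E. \<Sum>x\<in>B. (e \<bullet> x)\<^sup>2)"
    unfolding w_def by (subst sum.swap) (simp add: inner_commute)
  also have "\<dots> = real (card E)"
    using B E(3) by (simp add: Parseval_orthonormal)
  finally have sum_w: "sum w B = real (card E)" .
  have "w x \<le> 1" if "x \<in> B" for x
    using Bessel_orthonormal[OF E, of x] B(5)[OF that] by (simp add: w_def)
  moreover have "0 \<le> w x" for x
    by (simp add: w_def sum_nonneg)
  ultimately obtain T where T: "T \<subseteq> B" "card T = card E"
    and T_le: "(\<Sum>x\<in>T. (c x)\<^sup>2) \<le> (\<Sum>x\<in>B. w x * (c x)\<^sup>2)"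
    using sum_smallest_le_weighted_sum[OF B(1), of "\<lambda>x. (c x)\<^sup>2" w "card E"] sum_w by auto
  have S_inner: "(S *v e) \<bullet> x = c x * (x \<bullet> e)" if "x \<in> B" for e x
    using B(6)[OF that] by (simp add: sym_mats_inner[OF S] inner_commute[of e])
  \<comment> \<open>With these weights the sum of squared eigenvalues is the squared Frobenius norm
    of \<open>S\<close> restricted to the span of \<open>E\<close>.\<close>
  have "(\<Sum>x\<in>B. w x * (c x)\<^sup>2) = (\<Sum>x\<in>B. \<Sum>e\<in>E. ((S *v e) \<bullet> x)\<^sup>2)"
    by (intro sum.cong refl)
      (simp add: w_def sum_distrib_left S_inner power_mult_distrib mult.commute)
  also have "\<dots> = (\<Sum>e\<in>E. \<Sum>x\<in>B. ((S *v e) \<bullet> x)\<^sup>2)"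
    by (rule sum.swap)
  also have "\<dots> = (\<Sum>e\<in>E. (norm (S *v e))\<^sup>2)"
    using B by (intro sum.cong refl Parseval_orthonormal) auto
  finally have T_le: "(\<Sum>x\<in>T. (c x)\<^sup>2) \<le> (\<Sum>e\<in>E. (norm (S *v e))\<^sup>2)"
    using T_le by simp

  \<comment> \<open>\<open>h\<close> is \<open>S\<close> with the eigenvalues on \<open>T\<close>
    replaced by 0.\<close>
  define h where "h v = (\<Sum>x\<in>B - T. (c x * (v \<bullet> x)) *\<^sub>R x)" for v
  define Z where "Z = matrix h"
  have "linear h"
    unfolding h_def
    by (rule linearI) (simp_all add: inner_add_left algebra_simps sum.distrib scaleR_sum_right)
  hence Z: "Z *v v = h v" for v
    by (simp add: Z_def)
  have "(Z *v u) \<bullet> v = u \<bullet> (Z *v v)" for u v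
    by (simp add: Z h_def inner_sum_left inner_sum_right inner_commute[of v] mult_ac)
  hence "(transpose Z *v u - Z *v u) \<bullet> v = 0" for u v
    by (simp add: inner_diff_left inner_transpose_mult del: transpose_matrix_vector)
  hence "transpose Z *v u = Z *v u" for u
    using inner_eq_zero_iff[of "transpose Z *v u - Z *v u"] by (metis eq_iff_diff_eq_0)
  hence "Z \<in> sym_mats"
    by (simp add: sym_mats_def matrix_eq)
  moreover have "rank Z \<le> card (B - T)"
  proof -
    have "range ((*v) Z) \<subseteq> span (B - T)"
      unfolding Z h_def by (intro image_subsetI span_sum span_scale span_base)
    hence "rank Z \<le> dim (B - T)"
      unfolding rank_dim_range by (metis dim_span dim_subset)
    also have "\<dots> \<le> card (B - T)"
      using B(1) by (intro dim_le_card') simp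
    finally show ?thesis .
  qed
  \<comment> \<open>The second fact rules out truncation in the natural subtraction, so that it
    agrees with the integer bound in \<open>sym_mats_rank_le\<close>.\<close>
  moreover have "card (B - T) = CARD('n) - card E" "card E \<le> CARD('n)"
    using T B(1,2) card_mono[OF B(1) T(1)] by (simp_all add: card_Diff_subset finite_subset)
  ultimately have Z_mem: "Z \<in> sym_mats_rank_le (int CARD('n) - int (card E))"
    by (simp add: sym_mats_rank_le_def of_nat_diff[symmetric] del: of_nat_diff)
  have diff: "(S - Z) *v x = (if x \<in> T then c x *\<^sub>R x else 0)" if x: "x \<in> B" for x
  proof -
    have "h x = (\<Sum>y\<in>B - T. if y = x then c x *\<^sub>R x else 0)"
      unfolding h_def
    proof (rule sum.cong[OF refl])
      fix y assume "y \<in> B - T"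
      thus "(c y * (x \<bullet> y)) *\<^sub>R y = (if y = x then c x *\<^sub>R x else 0)"
        using x B(3,5) by (auto simp: pairwise_def orthogonal_def norm_eq_1)
    qed
    also have "\<dots> = (if x \<in> T then 0 else c x *\<^sub>R x)"
      using x B(1) by simp
    finally show ?thesis
      using x by (simp add: matrix_vector_mult_diff_rdistrib Z B(6))
  qed
  have "(norm (S - Z))\<^sup>2 = (\<Sum>x\<in>B. (norm ((S - Z) *v x))\<^sup>2)"
    using B by (intro norm_matrix_orthonormal_basis) auto
  also have "\<dots> = (\<Sum>x\<in>B. if x \<in> T then (c x)\<^sup>2 else 0)"
    using B(5) by (intro sum.cong refl) (simp add: diff)
  also have "\<dots> = (\<Sum>x\<in>T. (c x)\<^sup>2)"
    using T(1) B(1) by (simp add: sum.If_cases Int_absorb1)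
  finally show ?thesis
    using that[OF Z_mem] T_le by simp
qed

text \<open>The constant \<open>c\<close> bounds all singular values of \<open>Y\<close> from below.
  The normalized left singular vectors serve as \<open>E\<close> in the previous lemma, and
  \<open>S\<close> sends each of them to a vector at most \<open>1 / c\<close> times as long as the
  image under \<open>S ** Y\<close> of the corresponding right singular vector.\<close>

lemma low_rank_symmetric_approximation_of_product:
  fixes S :: "real^'n::finite^'n" and Y :: "real^'p::finite^'n"
  assumes S: "S \<in> sym_mats" and c: "0 < c" "\<And>u. c * norm u \<le> norm (Y *v u)"
  obtains Z where "Z \<in> sym_mats_rank_le (int CARD('n) - int CARD('p))"
    "c * norm (S - Z) \<le> norm (S ** Y)"
proof -
  have gram: "((transpose Y ** Y) *v u) \<bullet> v = (Y *v u) \<bullet> (Y *v v)" for u v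
    by (simp add: inner_transpose_mult del: transpose_matrix_vector flip: matrix_vector_mul_assoc)
  have "transpose Y ** Y \<in> sym_mats"
    by (simp add: sym_mats_def matrix_transpose_mul)
  from sym_mats_eigenbasis[OF this] obtain B d where B: "finite B" "card B = CARD('p)" "pairwise orthogonal B" "span B = UNIV"
    "\<And>u. u \<in> B \<Longrightarrow> norm u = 1" "\<And>u. u \<in> B \<Longrightarrow> (transpose Y ** Y) *v u = d u *\<^sub>R u"
    by blast
  have Y_pos: "0 < norm (Y *v u)" and Y_ge: "c \<le> norm (Y *v u)" if "u \<in> B" for u
    using c(1) c(2)[of u] B(5)[OF that] by auto
  have Y_orth: "(Y *v u) \<bullet> (Y *v v) = 0" if "u \<in> B" "v \<in> B" "u \<noteq> v" for u v
    using gram[of u v] that B(3) by (simp add: B(6) pairwise_def orthogonal_def)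
  \<comment> \<open>The Gram eigenvectors \<open>u\<close> are right singular vectors of
    \<open>Y\<close>, and \<open>q u\<close> are the matching left ones.\<close>
  define q where "q u = (Y *v u) /\<^sub>R norm (Y *v u)" for u
  have q_norm: "norm (q u) = 1" if "u \<in> B" for u
    using Y_pos[OF that] by (simp add: q_def)
  have q_orth: "q u \<bullet> q v = 0" if "u \<in> B" "v \<in> B" "u \<noteq> v" for u v
    using Y_orth[OF that] by (simp add: q_def)
  \<comment> \<open>Orthogonal unit vectors are distinct, so \<open>q\<close> keeps the cardinality
    \<open>p\<close> that enters the rank bound.\<close>
  have inj: "inj_on q B"
    using q_norm q_orth by (force simp: inj_on_def norm_eq_1)
  have "finite (q ` B)" "pairwise orthogonal (q ` B)" "\<And>e. e \<in> q ` B \<Longrightarrow> norm e = 1"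
    using B(1) q_norm q_orth by (auto simp: pairwise_def orthogonal_def)
  from low_rank_symmetric_approximation[OF S this] obtain Z where
    Z: "Z \<in> sym_mats_rank_le (int CARD('n) - int (card (q ` B)))"
      "(norm (S - Z))\<^sup>2 \<le> (\<Sum>e\<in>q ` B. (norm (S *v e))\<^sup>2)" by blast
  have "(c * norm (S - Z))\<^sup>2 \<le> c\<^sup>2 * (\<Sum>u\<in>B. (norm (S *v q u))\<^sup>2)"
    using Z(2) by (simp add: power_mult_distrib sum.reindex[OF inj] mult_left_mono)
  also have "\<dots> = (\<Sum>u\<in>B. (c * norm (S *v q u))\<^sup>2)"
    by (simp add: sum_distrib_left power_mult_distrib)
  also have "\<dots> \<le> (\<Sum>u\<in>B. (norm ((S ** Y) *v u))\<^sup>2)"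
  proof (intro sum_mono power_mono)
    fix u assume u: "u \<in> B"
    have "Y *v u = norm (Y *v u) *\<^sub>R q u"
      using Y_pos[OF u] by (simp add: q_def)
    hence "(S ** Y) *v u = norm (Y *v u) *\<^sub>R (S *v q u)"
      by (metis matrix_vector_mul_assoc matrix_vector_mult_scaleR)
    thus "c * norm (S *v q u) \<le> norm ((S ** Y) *v u)"
      using Y_ge[OF u] by (simp add: mult_right_mono)
  qed (use c in auto)
  also have "\<dots> = (norm (S ** Y))\<^sup>2"
    using B by (intro norm_matrix_orthonormal_basis[symmetric]) auto
  finally have "c * norm (S - Z) \<le> norm (S ** Y)"
    by (rule power2_le_imp_le) simp
  with Z(1) that show ?thesis
    by (simp add: card_image[OF inj] B(2))
qed

section \<open>Approximately critical pairs\<close>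

lemma norm_transpose: "norm (transpose X) = norm (X :: real^'p::finite^'n::finite)"
  using trace_mul_sym[of X "transpose X"] by (simp add: norm_matrix_eq_Frobenius)

text \<open>Cauchy-Schwarz for each entry, a row times a column; the resulting double sum
  factors.\<close>

lemma norm_matrix_matrix_mult_le:
  fixes X :: "real^'k::finite^'n::finite" and Y :: "real^'p::finite^'k"
  shows "norm (X ** Y) \<le> norm X * norm Y"
proof -
  have entry: "(X ** Y) $ i $ j = X $ i \<bullet> transpose Y $ j" for i j
    by (simp add: matrix_matrix_mult_def inner_vec_def transpose_def)
  have "(norm (X ** Y))\<^sup>2 = (\<Sum>i\<in>UNIV. \<Sum>j\<in>UNIV. (X $ i \<bullet> transpose Y $ j)\<^sup>2)"
    by (simp add: power2_norm_vec entry)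
  also have "\<dots> \<le> (\<Sum>i\<in>UNIV. \<Sum>j\<in>UNIV. (norm (X $ i))\<^sup>2 * (norm (transpose Y $ j))\<^sup>2)"
    by (intro sum_mono) (simp add: Cauchy_Schwarz_ineq power2_norm_eq_inner)
  also have "\<dots> = (norm X)\<^sup>2 * (norm (transpose Y))\<^sup>2"
    by (simp only: power2_norm_vec[of X] power2_norm_vec[of "transpose Y"] sum_product)
  also have "\<dots> = (norm X * norm Y)\<^sup>2"
    by (simp add: norm_transpose power_mult_distrib)
  finally show ?thesis
    by (rule power2_le_imp_le) simp
qed

lemma psd_mult_transpose: "psd (Y ** transpose (Y :: real^'p::finite^'n::finite))"
proof -
  have "v \<bullet> ((Y ** transpose Y) *v v) = (transpose Y *v v) \<bullet> (transpose Y *v v)" for v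
    using inner_transpose_mult[of Y v "transpose Y *v v"]
    by (simp flip: matrix_vector_mul_assoc)
  thus ?thesis
    by (simp add: psd_def sym_mats_def matrix_transpose_mul)
qed

section \<open>Rank-one matrices \<open>v u\<^sup>T\<close>\<close>

definition outer :: "real^'n \<Rightarrow> real^'p \<Rightarrow> real^'p^'n" where
  "outer v u = (\<chi> i j. v $ i * u $ j)"

lemma norm_outer: "norm (outer v u) = norm (v :: real^'n::finite) * norm (u :: real^'p::finite)"
proof -
  have "outer v u $ i = v $ i *\<^sub>R u" for i
    by (simp add: outer_def vec_eq_iff)
  hence "(norm (outer v u))\<^sup>2 = (norm v * norm u)\<^sup>2"
    by (simp add: power2_norm_vec[of "outer v u"] power2_norm_vec[of v] power_mult_distrib
        sum_distrib_right)
  thus ?thesis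
    by simp
qed

lemma outer_mult_transpose:
  "outer v u ** transpose Y = outer v ((Y :: real^'p::finite^'n::finite) *v u)"
  by (simp add: outer_def matrix_matrix_mult_def transpose_def matrix_vector_mult_def vec_eq_iff
      sum_distrib_left mult_ac)

lemma outer_mult_transpose_outer:
  fixes u :: "real^'p::finite"
  shows "outer v u ** transpose (outer v u) = (u \<bullet> u) *\<^sub>R outer v v"
  by (simp add: outer_def matrix_matrix_mult_def transpose_def inner_vec_def vec_eq_iff
      sum_distrib_left sum_distrib_right mult_ac)

lemma inner_outer: "S \<bullet> outer v w = (v :: real^'n::finite) \<bullet> (S *v (w :: real^'p::finite))"
  by (simp add: outer_def inner_vec_def matrix_vector_mult_def sum_distrib_left mult_ac)

section \<open>Closure properties of symmetric matrices, and tubes of Minkowski sums\<close>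

lemma sym_mats_add: "X \<in> sym_mats \<Longrightarrow> Y \<in> sym_mats \<Longrightarrow> X + Y \<in> sym_mats"
  and sym_mats_diff: "X \<in> sym_mats \<Longrightarrow> Y \<in> sym_mats \<Longrightarrow> X - Y \<in> sym_mats"
  and sym_mats_scaleR: "X \<in> sym_mats \<Longrightarrow> c *\<^sub>R X \<in> sym_mats"
  and sym_mats_mat: "mat c \<in> sym_mats"
  by (simp_all add: sym_mats_def transpose_def vec_eq_iff mat_def)

lemma adj_op_sym_mats:
  assumes "\<And>i. A i \<in> sym_mats"
  shows "adj_op A l \<in> sym_mats"
  using assms by (simp add: sym_mats_def adj_op_def transpose_def vec_eq_iff)

text \<open>Translation by an element of \<open>K\<close> preserves distances. Symmetry of
  \<open>K\<close> keeps the translates in \<open>sym_mats\<close>, to which tubes are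
  confined.\<close>

lemma tube_plus:
  fixes W K :: "(real^'n::finite^'n) set"
  assumes "K \<subseteq> sym_mats"
  shows "tube \<delta> W + K = tube \<delta> (W + K)"
proof (intro equalityI subsetI)
  fix X assume "X \<in> tube \<delta> W + K"
  then obtain U k Z where X: "X = U + k" "k \<in> K" "U \<in> sym_mats" "Z \<in> W" "norm (U - Z) \<le> \<delta>"
    by (auto simp: set_plus_def tube_def)
  have "X \<in> sym_mats"
    using X assms by (auto intro: sym_mats_add)
  moreover have "norm (X - (Z + k)) \<le> \<delta>"
    using X by simp
  ultimately show "X \<in> tube \<delta> (W + K)"
    using X(2,4) by (auto simp: tube_def set_plus_def)
next
  fix X assume "X \<in> tube \<delta> (W + K)"
  then obtain Z k where X: "X \<in> sym_mats" "k \<in> K" "Z \<in> W" "norm (X - (Z + k)) \<le> \<delta>"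
    by (auto simp: set_plus_def tube_def)
  have "X - k \<in> sym_mats"
    using X assms by (auto intro: sym_mats_diff)
  hence "X - k \<in> tube \<delta> W"
    using X by (auto simp: tube_def diff_diff_eq add.commute)
  hence "(X - k) + k \<in> tube \<delta> W + K"
    using X(2) by (rule set_plus_intro)
  thus "X \<in> tube \<delta> W + K"
    by simp
qed

text \<open>Of the four conditions of approximate optimality only the positivity of the slack matrix can
  fail at an approximately feasible, approximately critical pair.\<close>

lemma spurious_afac_negative_direction:
  assumes C: "C \<in> sym_mats" and A: "\<And>i. A i \<in> sym_mats"
    and sp: "spurious_afac A b R\<^sub>Y R\<^sub>l C \<epsilon>0 \<epsilon>1 \<epsilon>2 \<gamma> (Y :: real^'p::finite^'n::finite) l"
  obtains v where "norm v = 1" "v \<bullet> (slack A C l *v v) < - \<epsilon>2"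
proof -
  let ?S = "slack A C l"
  have afac: "norm (lin_op A (Y ** transpose Y) - b) \<le> \<epsilon>0" "norm (?S ** Y) \<le> \<epsilon>1"
    and bad: "\<not> sdp_approx_opt A b C \<epsilon>0 (R\<^sub>Y * \<epsilon>1) \<epsilon>2 (Y ** transpose Y) l"
    and RY: "norm Y \<le> R\<^sub>Y"
    using sp by (auto simp: spurious_afac_def afac_def)
  \<comment> \<open>Here the factor \<open>R\<^sub>Y\<close> in the complementarity tolerance
    arises: multiplying \<open>?S ** Y\<close> by \<open>transpose Y\<close> costs at most
    \<open>norm Y\<close>.\<close>
  have "norm (?S ** (Y ** transpose Y)) \<le> norm (?S ** Y) * norm Y"
    using norm_matrix_matrix_mult_le[of "?S ** Y" "transpose Y"]
    by (simp add: matrix_mul_assoc norm_transpose)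
  also have "\<dots> \<le> \<epsilon>1 * R\<^sub>Y"
    using afac(2) RY by (intro mult_mono) (auto intro: order_trans[OF norm_ge_zero])
  finally have "\<not> psd (?S - (- \<epsilon>2) *\<^sub>R mat 1)"
    using bad afac(1) psd_mult_transpose[of Y] by (simp add: sdp_approx_opt_def mult.commute)
  moreover have "?S - (- \<epsilon>2) *\<^sub>R mat 1 \<in> sym_mats"
    using C A unfolding slack_def
    by (intro sym_mats_diff sym_mats_scaleR sym_mats_mat adj_op_sym_mats)
  ultimately obtain v where "v \<bullet> ((?S - (- \<epsilon>2) *\<^sub>R mat 1) *v v) < 0"
    by (auto simp: psd_def not_le)
  hence v: "v \<bullet> (?S *v v) < - \<epsilon>2 * (norm v)\<^sup>2"
    by (simp add: matrix_vector_mult_diff_rdistrib matrix_vector_mult_add_rdistrib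
        scaleR_matrix_vector_assoc[symmetric] inner_add_right power2_norm_eq_inner)
  \<comment> \<open>Both sides vanish at 0, so strictness excludes it; both scale quadratically, so
    \<open>v\<close> may be normalized.\<close>
  hence "v \<noteq> 0" by auto
  hence "(v /\<^sub>R norm v) \<bullet> (?S *v (v /\<^sub>R norm v)) < - \<epsilon>2"
    using v by (simp add: matrix_vector_mult_scaleR field_simps power2_eq_square)
  moreover have "norm (v /\<^sub>R norm v) = 1"
    using \<open>v \<noteq> 0\<close> by simp
  ultimately show ?thesis using that by blast
qed

text \<open>The direction \<open>v u\<^sup>T\<close> has curvature below
  \<open>- \<epsilon>2\<close>, so it cannot satisfy the constraint with \<open>\<gamma>\<close>.
  Its image under the linearized constraint is that of \<open>v (Y u)\<^sup>T\<close>, of norm at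
  most \<open>op_norm A * norm (Y *v u)\<close>.\<close>

lemma afac_norm_mult_vec_ge:
  fixes A :: "'m::finite \<Rightarrow> real^'n::finite^'n" and Y :: "real^'p::finite^'n"
  assumes A: "\<And>i. A i \<in> sym_mats" and "0 < \<gamma>"
    and afac: "afac A b C \<epsilon>0 \<epsilon>1 \<epsilon>2 \<gamma> Y l"
    and v: "norm v = 1" "v \<bullet> (slack A C l *v v) < - \<epsilon>2"
  shows "0 < op_norm A" "\<gamma> / op_norm A * norm u \<le> norm (Y *v u)"
proof -
  have bl: "bounded_linear (lin_op A)"
    using linear_lin_op linear_conv_bounded_linear by blast
  have key: "\<gamma> < op_norm A * norm (Y *v u)" if "norm u = 1" for u
  proof -
    let ?U = "outer v u"
    have "slack A C l \<bullet> (?U ** transpose ?U) < - \<epsilon>2"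
      using v(2) that by (simp add: outer_mult_transpose_outer inner_outer norm_eq_1)
    moreover have "norm ?U = 1"
      using v(1) that by (simp add: norm_outer)
    ultimately have "\<gamma> < norm (lin_op A (?U ** transpose Y))"
      using afac by (fastforce simp: afac_def)
    \<comment> \<open>This matrix need not be symmetric; the bound extends to it because
      \<open>op_norm\<close> equals the norm over all matrices.\<close>
    also have "\<dots> \<le> op_norm A * norm (?U ** transpose Y)"
      using onorm[OF bl] by (simp add: op_norm_eq_onorm[OF A])
    also have "\<dots> = op_norm A * norm (Y *v u)"
      using v(1) by (simp add: outer_mult_transpose norm_outer)
    finally show ?thesis .
  qed
  \<comment> \<open>A unit vector exists because \<open>p\<close> is at least 1; a positive product
    with a norm forces \<open>op_norm A\<close> to be positive.\<close>
  obtain e :: "real^'p" where "norm e = 1"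
    using vector_choose_size[of 1] by auto
  from key[OF this] \<open>0 < \<gamma>\<close> have "0 < op_norm A * norm (Y *v e)" by linarith
  thus pos: "0 < op_norm A"
    by (simp add: zero_less_mult_iff)
  show "\<gamma> / op_norm A * norm u \<le> norm (Y *v u)"
  proof (cases "u = 0")
    case False
    hence "\<gamma> < op_norm A * norm (Y *v (u /\<^sub>R norm u))"
      by (intro key) simp
    thus ?thesis
      using pos False by (simp add: matrix_vector_mult_scaleR field_simps)
  qed simp
qed

theorem proposition3p8:
  fixes A :: "'m::finite \<Rightarrow> real^'n::finite^'n"
    and b :: "real^'m"
    and R\<^sub>Y R\<^sub>l \<epsilon>0 \<epsilon>1 \<epsilon>2 \<gamma> :: real
  assumes "\<And>i. A i \<in> sym_mats"
    and "\<exists>X\<in>sym_mats. lin_op A X \<noteq> 0"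
    and "0 \<le> R\<^sub>Y" and "0 \<le> R\<^sub>l"
    and "0 \<le> \<epsilon>0" and "0 \<le> \<epsilon>1" and "0 \<le> \<epsilon>2"
    and "0 < \<gamma>"
  shows "let \<delta> = \<epsilon>1 * op_norm A / \<gamma>;
             B = {l :: real^'m. norm l \<le> R\<^sub>l};
             L = sym_mats_rank_le (int CARD('n) - int CARD('p::finite)) :: (real^'n^'n) set
         in spurious_costs TYPE('p) A b R\<^sub>Y R\<^sub>l \<epsilon>0 \<epsilon>1 \<epsilon>2 \<gamma> \<subseteq> tube \<delta> L + adj_op A ` B
          \<and> tube \<delta> L + adj_op A ` B = tube \<delta> (L + adj_op A ` B)"
proof -
  let ?\<delta> = "\<epsilon>1 * op_norm A / \<gamma>"
  let ?B = "{l :: real^'m. norm l \<le> R\<^sub>l}"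
  let ?L = "sym_mats_rank_le (int CARD('n) - int CARD('p)) :: (real^'n^'n) set"
  have "spurious_costs TYPE('p) A b R\<^sub>Y R\<^sub>l \<epsilon>0 \<epsilon>1 \<epsilon>2 \<gamma> \<subseteq> tube ?\<delta> ?L + adj_op A ` ?B"
  proof
    fix C assume "C \<in> spurious_costs TYPE('p) A b R\<^sub>Y R\<^sub>l \<epsilon>0 \<epsilon>1 \<epsilon>2 \<gamma>"
    then obtain Y :: "real^'p^'n" and l where C: "C \<in> sym_mats"
      and sp: "spurious_afac A b R\<^sub>Y R\<^sub>l C \<epsilon>0 \<epsilon>1 \<epsilon>2 \<gamma> Y l"
      by (auto simp: spurious_costs_def)
    have afac: "afac A b C \<epsilon>0 \<epsilon>1 \<epsilon>2 \<gamma> Y l" and l: "norm l \<le> R\<^sub>l"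
      using sp by (simp_all add: spurious_afac_def)
    let ?S = "slack A C l"
    have S: "?S \<in> sym_mats"
      using C assms(1) unfolding slack_def by (intro sym_mats_diff adj_op_sym_mats)
    obtain v where v: "norm v = 1" "v \<bullet> (?S *v v) < - \<epsilon>2"
      using spurious_afac_negative_direction[OF C assms(1) sp] .
    note Y = afac_norm_mult_vec_ge[OF assms(1,8) afac v]
    have c: "0 < \<gamma> / op_norm A"
      using Y(1) assms(8) by simp
    \<comment> \<open>The lower bound \<open>\<gamma> / op_norm A\<close> on the singular values
      turns \<open>\<epsilon>1\<close> into the tube radius. For \<open>p > n\<close> the set
      \<open>?L\<close> is empty, so obtaining \<open>Z\<close> shows that no spurious pair
      exists.\<close>
    obtain Z where Z: "Z \<in> ?L" "\<gamma> / op_norm A * norm (?S - Z) \<le> norm (?S ** Y)"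
      using low_rank_symmetric_approximation_of_product[OF S c Y(2)] .
    have "\<gamma> / op_norm A * norm (?S - Z) \<le> \<epsilon>1"
      using Z(2) afac by (simp add: afac_def)
    hence "norm (?S - Z) \<le> ?\<delta>"
      using Y(1) assms(8) by (simp add: field_simps)
    hence "?S \<in> tube ?\<delta> ?L"
      using S Z(1) by (auto simp: tube_def)
    \<comment> \<open>By the definition of the slack matrix this sum is \<open>C\<close>.\<close>
    hence "?S + adj_op A l \<in> tube ?\<delta> ?L + adj_op A ` ?B"
      using l by (intro set_plus_intro) auto
    thus "C \<in> tube ?\<delta> ?L + adj_op A ` ?B"
      by (simp add: slack_def)
  qed
  moreover have "tube ?\<delta> ?L + adj_op A ` ?B = tube ?\<delta> (?L + adj_op A ` ?B)"
    using adj_op_sym_mats[OF assms(1)] by (intro tube_plus) auto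
  ultimately show ?thesis
    by (simp only: Let_def)
qed

end
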